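(* Let $(\mathscr{A},\ast,\alpha)$ be a Hom-anti-associative algebra whose structure map is multiplicative, i.e. $\alpha(x\ast y)=\alpha(x)\ast\alpha(y)$ for all $x,y\in\mathscr{A}$, and let $R:\mathscr{A}\to\mathscr{A}$ be a Rota-Baxter operator of weight $0$ on $(\mathscr{A},\ast,\alpha)$. Then $(\mathscr{A},\succ,\prec,\alpha)$ is a Hom-rhizaform algebra, where $$x\succ y=R(x)\ast y,\qquad x\prec y=x\ast R(y),\qquad x,y\in\mathscr{A}.$$
   Context: All vector spaces are over a fixed field $\mathbb{F}$. A Hom-anti-associative algebra $(\mathscr{A},\ast,\alpha)$ is a vector space with a bilinear product $\ast$ and a linear map $\alpha:\mathscr{A}\to\mathscr{A}$ such that $\alpha(x)\ast(y\ast z)=-(x\ast y)\ast\alpha(z)$ for all $x,y,z$. A Rota-Baxter operator of weight $0$ on $(\mathscr{A},\ast,\alpha)$ is a linear map $R:\mathscr{A}\to\mathscr{A}$ with $R\circ\alpha=\alpha\circ R$ and $R(x)\ast R(y)=R\big(R(x)\ast y+x\ast R(y)\big)$ for all $x,y\in\mathscr{A}$. A Hom-rhizaform algebra is a quadruple $(\mathscr{A},\succ,\prec,\alpha)$ with $\mathscr{A}$ a vector space, $\succ,\prec$ bilinear operations on $\mathscr{A}$ and $\alpha:\mathscr{A}\to\mathscr{A}$ linear such that for all $x,y,z\in\mathscr{A}$: $\alpha(x\prec y)=\alpha(x)\prec\alpha(y)$, $\alpha(x\succ y)=\alpha(x)\succ\alpha(y)$, and $$(x\succ y+x\prec y)\succ\alpha(z)=-\alpha(x)\succ(y\succ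 z),$$ $$\alpha(x)\prec(y\succ z+y\prec z)=-(x\prec y)\prec\alpha(z),$$ $$\alpha(x)\succ(y\prec z)=-(x\succ y)\prec\alpha(z).$$ *)

theory Defs
  imports Complex_Main
begin

(* The underlying vector space is the whole type 'a, over the field 'f, with scalar
   multiplication scale as in the library locale vector_space. *)

definition bilinear_op ::
  "('f::field \<Rightarrow> 'a::ab_group_add \<Rightarrow> 'a) \<Rightarrow> ('a \<Rightarrow> 'a \<Rightarrow> 'a) \<Rightarrow> bool" where
  "bilinear_op scale m \<longleftrightarrow>
     (\<forall>x. Vector_Spaces.linear scale scale (\<lambda>y. m x y)) \<and>
     (\<forall>y. Vector_Spaces.linear scale scale (\<lambda>x. m x y))"

(* Multiplicativity of \<alpha> is deliberately not part of this notion. *)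
locale hom_anti_associative = vector_space scale
  for scale :: "'f::field \<Rightarrow> 'a::ab_group_add \<Rightarrow> 'a" +
  fixes mult :: "'a \<Rightarrow> 'a \<Rightarrow> 'a" (infixl "\<star>" 70)
    and \<alpha> :: "'a \<Rightarrow> 'a"
  assumes bilinear_mult: "bilinear_op scale (\<star>)"
    and linear_alpha: "Vector_Spaces.linear scale scale \<alpha>"
    and hom_anti_assoc: "\<alpha> x \<star> (y \<star> z) = - ((x \<star> y) \<star> \<alpha> z)"

locale rota_baxter_weight_zero = hom_anti_associative scale mult \<alpha>
  for scale :: "'f::field \<Rightarrow> 'a::ab_group_add \<Rightarrow> 'a"
    and mult :: "'a \<Rightarrow> 'a \<Rightarrow> 'a" (infixl "\<star>" 70)
    and \<alpha> :: "'a \<Rightarrow> 'a" +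
  fixes R :: "'a \<Rightarrow> 'a"
  assumes linear_R: "Vector_Spaces.linear scale scale R"
    and R_alpha_commute: "R \<circ> \<alpha> = \<alpha> \<circ> R"
    and rota_baxter: "R x \<star> R y = R (R x \<star> y + x \<star> R y)"

locale hom_rhizaform = vector_space scale
  for scale :: "'f::field \<Rightarrow> 'a::ab_group_add \<Rightarrow> 'a" +
  fixes succ :: "'a \<Rightarrow> 'a \<Rightarrow> 'a" (infixl "\<succ>" 70)
    and prec :: "'a \<Rightarrow> 'a \<Rightarrow> 'a" (infixl "\<prec>" 70)
    and \<alpha> :: "'a \<Rightarrow> 'a"
  assumes bilinear_succ: "bilinear_op scale (\<succ>)"
    and bilinear_prec: "bilinear_op scale (\<prec>)"
    and linear_alpha: "Vector_Spaces.linear scale scale \<alpha>"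
    and alpha_prec: "\<alpha> (x \<prec> y) = \<alpha> x \<prec> \<alpha> y"
    and alpha_succ: "\<alpha> (x \<succ> y) = \<alpha> x \<succ> \<alpha> y"
    and succ_succ: "(x \<succ> y + x \<prec> y) \<succ> \<alpha> z = - (\<alpha> x \<succ> (y \<succ> z))"
    and prec_prec: "\<alpha> x \<prec> (y \<succ> z + y \<prec> z) = - ((x \<prec> y) \<prec> \<alpha> z)"
    and succ_prec: "\<alpha> x \<succ> (y \<prec> z) = - ((x \<succ> y) \<prec> \<alpha> z)"

end

theory Submission
  imports Defs
begin

text \<open>
  The Rota-Baxter identity says exactly that \<open>R (x \<succ> y + x \<prec> y) = R x \<star> R y\<close>: the map \<open>R\<close> turns the
  sum of the two new products back into the original one.  Hence each of the three rhizaform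
  identities is an instance of Hom-anti-associativity in which \<open>R\<close> has been applied to two of the
  three arguments: to \<open>x\<close> and \<open>y\<close>, to \<open>y\<close> and \<open>z\<close>, or to \<open>x\<close> and \<open>z\<close>.  In the first two cases
  one factor is \<open>R\<close> of a sum of new products, which the Rota-Baxter identity rewrites as a single
  product of the two images under \<open>R\<close>.
  Commutation of \<open>R\<close> with \<open>\<alpha>\<close> identifies the twisted arguments, and together with
  multiplicativity of \<open>\<alpha>\<close> it makes \<open>\<alpha>\<close> an endomorphism of both new products.
\<close>

lemma bilinear_op_precompose:
  assumes m: "bilinear_op scale m"
    and f: "Vector_Spaces.linear scale scale f"
    and g: "Vector_Spaces.linear scale scale g"
  shows "bilinear_op scale (\<lambda>x y. m (f x) (g y))"
proof -
  have "Vector_Spaces.linear scale scale (\<lambda>y. m (f x) (g y))" for x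
    using Vector_Spaces.linear_compose[OF g, of scale "m (f x)"] m
    by (simp add: bilinear_op_def o_def)
  moreover have "Vector_Spaces.linear scale scale (\<lambda>x. m (f x) (g y))" for y
    using Vector_Spaces.linear_compose[OF f, of scale "\<lambda>x. m x (g y)"] m
    by (simp add: bilinear_op_def o_def)
  ultimately show ?thesis
    by (simp add: bilinear_op_def)
qed

theorem corollary3p3:
  fixes scale :: "'f::field \<Rightarrow> 'a::ab_group_add \<Rightarrow> 'a"
    and mult :: "'a \<Rightarrow> 'a \<Rightarrow> 'a"
    and \<alpha> R :: "'a \<Rightarrow> 'a"
  assumes "hom_anti_associative scale mult \<alpha>"
    and "\<And>x y. \<alpha> (mult x y) = mult (\<alpha> x) (\<alpha> y)"
    and "rota_baxter_weight_zero scale mult \<alpha> R"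
  shows "hom_rhizaform scale (\<lambda>x y. mult (R x) y) (\<lambda>x y. mult x (R y)) \<alpha>"
proof -
  interpret rota_baxter_weight_zero scale mult \<alpha> R
    by (fact assms(3))
  have R_alpha: "R (\<alpha> x) = \<alpha> (R x)" for x
    using R_alpha_commute by (simp add: fun_eq_iff)
  show ?thesis
  proof (intro hom_rhizaform.intro hom_rhizaform_axioms.intro)
    fix x y z
    show "vector_space scale"
      by (fact vector_space_axioms)
    show "Vector_Spaces.linear scale scale \<alpha>"
      by (fact linear_alpha)
    show "bilinear_op scale (\<lambda>x y. mult (R x) y)"
      by (rule bilinear_op_precompose[OF bilinear_mult linear_R linear_ident])
    show "bilinear_op scale (\<lambda>x y. mult x (R y))"
      by (rule bilinear_op_precompose[OF bilinear_mult linear_ident linear_R])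
    show "\<alpha> (mult x (R y)) = mult (\<alpha> x) (R (\<alpha> y))"
      by (simp add: assms(2) R_alpha)
    show "\<alpha> (mult (R x) y) = mult (R (\<alpha> x)) (\<alpha> y)"
      by (simp add: assms(2) R_alpha)
    show "mult (R (mult (R x) y + mult x (R y))) (\<alpha> z) = - mult (R (\<alpha> x)) (mult (R y) z)"
      by (simp add: R_alpha hom_anti_assoc flip: rota_baxter)
    show "mult (\<alpha> x) (R (mult (R y) z + mult y (R z))) = - mult (mult x (R y)) (R (\<alpha> z))"
      by (simp add: R_alpha hom_anti_assoc flip: rota_baxter)
    show "mult (R (\<alpha> x)) (mult y (R z)) = - mult (mult (R x) y) (R (\<alpha> z))"
      by (simp add: R_alpha hom_anti_assoc)
  qed
qed

end
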